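(* Let $a\in(0,1)$ and $\phi_a(z)=az+(1-a)$. If $f\in H^2$ is an eigenvector for $C_{\phi_a}$, then $f$ has an analytic continuation from $\mathbb{D}$ to all of the half-plane $\mathbb{H}=\{z\in\mathbb{C}:\mathrm{Re}(z)<1\}$.
   Context: $H^2=H^2(\mathbb{D})$ is the Hardy space of the open unit disk $\mathbb{D}$, and $C_{\phi_a}f=f\circ\phi_a$. *)

theory Defs
  imports "HOL-Complex_Analysis.Complex_Analysis"
begin

text \<open>
  Elements of the Hardy space are functions on the open unit disc \<^term>\<open>ball 0 1 :: complex set\<close>.
  They are represented by total functions whose values outside the disc are irrelevant, so
  equality of elements (in particular being nonzero) means equality on the disc.
\<close>

definition Hardy2 :: "(complex \<Rightarrow> complex) set" where
  "Hardy2 = {f. f holomorphic_on ball 0 1 \<and>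
     bdd_above ((\<lambda>r::real. 1 / (2 * pi) *
       integral {0..2 * pi} (\<lambda>t. (norm (f (of_real r * cis t)))\<^sup>2)) ` {0..<1})}"

definition comp_op :: "(complex \<Rightarrow> complex) \<Rightarrow> (complex \<Rightarrow> complex) \<Rightarrow> complex \<Rightarrow> complex" where
  "comp_op \<phi> f = f \<circ> \<phi>"

definition affine_symbol :: "real \<Rightarrow> complex \<Rightarrow> complex" where
  "affine_symbol a z = of_real a * z + (1 - of_real a)"

definition Hardy2_eigenvector ::
  "((complex \<Rightarrow> complex) \<Rightarrow> complex \<Rightarrow> complex) \<Rightarrow> (complex \<Rightarrow> complex) \<Rightarrow> bool" where
  "Hardy2_eigenvector T f \<longleftrightarrow> f \<in> Hardy2 \<and> (\<exists>z\<in>ball 0 1. f z \<noteq> 0) \<and>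
     (\<exists>\<mu>::complex. \<forall>z\<in>ball 0 1. T f z = \<mu> * f z)"

end

theory Submission
  imports Defs
begin

text \<open>
  Write \<open>\<phi>\<close> for the symbol and \<open>D\<close> for the disc. The eigenvalue equation
  \<open>f \<circ> \<phi> = \<mu> f\<close> says that \<open>f z\<close> can be recovered from the value of \<open>f\<close> at any iterate:
  \<open>f z = f (\<phi>\<^sup>n z) / \<mu>\<^sup>n\<close>. The right-hand side makes sense whenever \<open>\<phi>\<^sup>n z\<close> lies in the disc, which is
  a weaker condition on \<open>z\<close> the larger \<open>n\<close> is, so it continues \<open>f\<close> to the increasing union of the
  preimages of \<open>D\<close> under the iterates (\<open>Schroeder_continuation\<close>). Since
  \<open>\<phi>\<^sup>n z = 1 - a\<^sup>n (1 - z)\<close>, the preimages are the discs of radius \<open>1 / a\<^sup>n\<close> that touch the line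
  \<open>Re z = 1\<close> from the left at \<open>1\<close>, and these exhaust the half-plane (\<open>affine_symbol_orbit_meets_disc\<close>).
  Dividing by \<open>\<mu>\<close> is legitimate because \<open>\<mu> = 0\<close> would make \<open>f\<close> vanish on the nonempty open set
  \<open>\<phi> D\<close>, hence on all of \<open>D\<close>.
\<close>

text \<open>
  Two admissible iteration counts give the same value because passing from \<open>n\<close> to \<open>n + 1\<close>
  multiplies both \<open>f (\<phi>\<^sup>n z)\<close> and \<open>\<mu>\<^sup>n\<close> by \<open>\<mu>\<close>. So the least count may serve to
  define the continuation, while each fixed count shows that it is holomorphic on one preimage.
\<close>

lemma Schroeder_continuation:
  fixes f \<phi> :: "complex \<Rightarrow> complex"
  assumes D: "open D" and f: "f holomorphic_on D" and \<phi>: "\<phi> holomorphic_on UNIV"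
    and maps: "\<And>z. z \<in> D \<Longrightarrow> \<phi> z \<in> D"
    and eigen: "\<And>z. z \<in> D \<Longrightarrow> f (\<phi> z) = \<mu> * f z" and "\<mu> \<noteq> 0"
  obtains g where "g holomorphic_on (\<Union>n. (\<phi> ^^ n) -` D)" and "\<And>z. z \<in> D \<Longrightarrow> g z = f z"
proof -
  define g where
    "g z = (let n = LEAST n. (\<phi> ^^ n) z \<in> D in f ((\<phi> ^^ n) z) / \<mu> ^ n)" for z
  have shift: "(\<phi> ^^ (m + k)) z \<in> D \<and> f ((\<phi> ^^ (m + k)) z) / \<mu> ^ (m + k) = f ((\<phi> ^^ m) z) / \<mu> ^ m"
    if "(\<phi> ^^ m) z \<in> D" for m k z
    using that \<open>\<mu> \<noteq> 0\<close> by (induction k) (auto simp: maps eigen)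
  have g_eq: "g z = f ((\<phi> ^^ n) z) / \<mu> ^ n" if n: "(\<phi> ^^ n) z \<in> D" for n z
  proof -
    define m where "m = (LEAST n. (\<phi> ^^ n) z \<in> D)"
    have "(\<phi> ^^ m) z \<in> D" and "m \<le> n"
      unfolding m_def using n by (auto intro: LeastI Least_le)
    then show ?thesis
      using shift[of m z "n - m"] by (simp add: g_def flip: m_def)
  qed
  have iter: "(\<phi> ^^ n) holomorphic_on UNIV" for n
  proof (induction n)
    case 0
    then show ?case by (simp add: id_def)
  next
    case (Suc n)
    then show ?case
      using holomorphic_on_compose_gen[OF _ \<phi>, of "\<phi> ^^ n" UNIV] by (simp add: o_def)
  qed
  have "g holomorphic_on (\<Union>n. (\<phi> ^^ n) -` D)"
  proof (rule holomorphic_on_UN_open)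
    fix n
    show "open ((\<phi> ^^ n) -` D)"
      using D iter[of n] by (simp add: open_vimage holomorphic_on_imp_continuous_on)
    have "(\<phi> ^^ n) holomorphic_on (\<phi> ^^ n) -` D"
      using iter[of n] by (rule holomorphic_on_subset) simp
    then have "(f \<circ> (\<phi> ^^ n)) holomorphic_on (\<phi> ^^ n) -` D"
      using f by (rule holomorphic_on_compose_gen) auto
    then have "(\<lambda>z. f ((\<phi> ^^ n) z) / \<mu> ^ n) holomorphic_on (\<phi> ^^ n) -` D"
      using \<open>\<mu> \<noteq> 0\<close> by (auto intro!: holomorphic_intros simp: o_def)
    then show "g holomorphic_on (\<phi> ^^ n) -` D"
      by (rule holomorphic_transform) (simp add: g_eq)
  qed
  moreover have "g z = f z" if "z \<in> D" for z
    using g_eq[of 0 z] that by simp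
  ultimately show thesis using that by blast
qed

lemma affine_symbol_funpow: "(affine_symbol a ^^ n) z = 1 - of_real (a ^ n) * (1 - z)"
proof (induction n)
  case (Suc n)
  have "(affine_symbol a ^^ Suc n) z = affine_symbol a (1 - of_real (a ^ n) * (1 - z))"
    using Suc by simp
  also have "\<dots> = 1 - of_real (a ^ Suc n) * (1 - z)"
    by (simp add: affine_symbol_def algebra_simps)
  finally show ?case .
qed simp

lemma affine_symbol_in_disc:
  assumes "0 < a" and "a < 1" and "z \<in> ball 0 1"
  shows "affine_symbol a z \<in> ball 0 1"
proof -
  have "norm (affine_symbol a z) \<le> norm (of_real a * z) + norm (of_real (1 - a) :: complex)"
    unfolding affine_symbol_def of_real_diff of_real_1 by (rule norm_triangle_ineq)
  also have "\<dots> = a * norm z + (1 - a)"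
    using assms by (simp add: norm_mult flip: of_real_diff)
  also have "\<dots> < 1" using assms by simp
  finally show ?thesis by simp
qed

text \<open>
  With \<open>w = 1 - z\<close> and \<open>t = a\<^sup>n\<close> one has \<open>\<bar>1 - t w\<bar>\<^sup>2 = 1 - t (2 Re w - t \<bar>w\<bar>\<^sup>2)\<close>. As \<open>Re w > 0\<close>, the
  bracket is positive once \<open>t\<close> is small: the orbit tends to the fixed point \<open>1\<close>
  along a segment whose part near \<open>1\<close> lies in the disc.
\<close>

lemma affine_symbol_orbit_meets_disc:
  assumes "0 < a" and "a < 1" and "Re z < 1"
  obtains n where "(affine_symbol a ^^ n) z \<in> ball 0 1"
proof -
  define w where "w = 1 - z"
  have w: "Re w > 0" using assms by (simp add: w_def)
  then have "norm w > 0" by auto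
  then obtain n where n: "a ^ n < 2 * Re w / (norm w)\<^sup>2"
    using real_arch_pow_inv[of "2 * Re w / (norm w)\<^sup>2" a] w assms by auto
  define t where "t = a ^ n"
  have "t > 0" using assms by (simp add: t_def)
  have "(norm (1 - of_real t * w))\<^sup>2 = 1 - t * (2 * Re w - t * (norm w)\<^sup>2)"
    unfolding cmod_power2 by (simp add: power2_eq_square algebra_simps)
  moreover have "2 * Re w - t * (norm w)\<^sup>2 > 0"
    using n \<open>norm w > 0\<close> by (simp add: t_def field_simps)
  ultimately have "(norm (1 - of_real t * w))\<^sup>2 < 1\<^sup>2"
    using \<open>t > 0\<close> by simp
  then have "norm (1 - of_real t * w) < 1"
    by (rule power2_less_imp_less) simp
  then show thesis
    using that[of n] unfolding affine_symbol_funpow by (simp add: t_def w_def)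
qed

text \<open>
  If \<open>f \<circ> \<phi> = 0\<close> on the disc, then \<open>f\<close> vanishes on \<open>\<phi> D\<close>, which is open by the open mapping
  theorem, and the identity theorem gives \<open>f = 0\<close>.
\<close>

lemma comp_affine_symbol_eq_0_imp_eq_0:
  assumes a: "0 < a" "a < 1" and f: "f holomorphic_on ball 0 1"
    and zero: "\<And>z. z \<in> ball 0 1 \<Longrightarrow> f (affine_symbol a z) = 0" and "z \<in> ball 0 1"
  shows "f z = 0"
proof (rule analytic_continuation_open[where f = f and g = "\<lambda>_. 0"])
  let ?U = "affine_symbol a ` ball 0 1"
  show "?U \<subseteq> ball 0 1" using affine_symbol_in_disc a by blast
  have "inj_on (affine_symbol a) (ball 0 1)"
    using a by (simp add: inj_on_def affine_symbol_def)
  moreover have "affine_symbol a holomorphic_on ball 0 1"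
    unfolding affine_symbol_def by (intro holomorphic_intros)
  ultimately show "open ?U"
    by (intro open_mapping_thm3) auto
qed (use f zero \<open>z \<in> ball 0 1\<close> in auto)

theorem proposition23:
  fixes a :: real and f :: "complex \<Rightarrow> complex"
  assumes "0 < a" and "a < 1"
    and "Hardy2_eigenvector (comp_op (affine_symbol a)) f"
  shows "\<exists>g. g analytic_on {z. Re z < 1} \<and> (\<forall>z\<in>ball 0 1. g z = f z)"
proof -
  have f: "f holomorphic_on ball 0 1" and nonzero: "\<exists>z\<in>ball 0 1. f z \<noteq> 0"
    using assms(3) by (simp_all add: Hardy2_eigenvector_def Hardy2_def)
  obtain \<mu> where eigen: "\<And>z. z \<in> ball 0 1 \<Longrightarrow> f (affine_symbol a z) = \<mu> * f z"
    using assms(3) unfolding Hardy2_eigenvector_def comp_op_def o_def by metis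
  have "\<mu> \<noteq> 0"
  proof
    assume "\<mu> = 0"
    then have "f z = 0" if "z \<in> ball 0 1" for z
      using comp_affine_symbol_eq_0_imp_eq_0[OF assms(1,2) f _ that] eigen by simp
    with nonzero show False by blast
  qed
  have entire: "affine_symbol a holomorphic_on UNIV"
    unfolding affine_symbol_def by (intro holomorphic_intros)
  obtain g where g: "g holomorphic_on (\<Union>n. (affine_symbol a ^^ n) -` ball 0 1)"
    and g_f: "\<And>z. z \<in> ball 0 1 \<Longrightarrow> g z = f z"
    by (rule Schroeder_continuation[OF open_ball f entire _ _ \<open>\<mu> \<noteq> 0\<close>])
      (simp_all add: affine_symbol_in_disc[OF assms(1,2)] eigen del: mem_ball mem_ball_0)
  have "{z. Re z < 1} \<subseteq> (\<Union>n. (affine_symbol a ^^ n) -` ball 0 1)"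
  proof
    fix z :: complex
    assume "z \<in> {z. Re z < 1}"
    then obtain n where "(affine_symbol a ^^ n) z \<in> ball 0 1"
      using affine_symbol_orbit_meets_disc[OF assms(1,2), of z] by auto
    then show "z \<in> (\<Union>n. (affine_symbol a ^^ n) -` ball 0 1)" by blast
  qed
  with g have "g holomorphic_on {z. Re z < 1}"
    by (rule holomorphic_on_subset)
  then have "g analytic_on {z. Re z < 1}"
    by (simp add: analytic_on_open open_halfspace_Re_lt)
  with g_f show ?thesis by blast
qed

end
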